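(* Let $A$ be a real symmetric $n\times n$ matrix with rank $r(A)\ge3$ and eigenvalues $\lambda_1,\dots,\lambda_n$, let $1\le k\le n-1$ be such that $\lambda_1\le\cdots\le\lambda_k<0$ are the $k$ smallest eigenvalues of $A$, let $r(A)-k$ be even, and let $a_k=\max_{k+1\le i\le n}|\lambda_i|>0$. Set $$\phi_i=\frac{\frac{-\lambda_i}{(r(A)-k)a_k}}{\frac{-\lambda_i}{a_k}+1}\quad(1\le i\le k),\qquad c_{k,l}=\frac{\big(\frac{r(A)-k}{2}\big)!}{\prod_{i=1}^k\big(\frac{-\lambda_i}{a_k}+1\big)^{\frac12}}\sum_{\substack{j_1,\dots,j_k\ge0\\ j_1+\cdots+j_k=l}}\ \prod_{i=1}^k\frac{(2j_i-1)!!}{j_i!}\phi_i^{j_i}\quad(l\ge0).$$ Then the numbers $c_{k,l}$ satisfy the recursion $$c_{k,0}=\frac{\big(\frac{r(A)-k}{2}\big)!}{\prod_{i=1}^k\big(\frac{-\lambda_i}{a_k}+1\big)^{\frac12}},\qquad c_{k,l}=\frac{1}{2l}\sum_{j=0}^{l-1}d_{k,l-j}\,c_{k,j},\quad l\ge1,$$ where $d_{k,l}=\sum_{i=1}^k(2\phi_i)^l$ for $l\ge1$.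
   Context: Convention: $(2j-1)!!=1$ for $j=0$ and $(2j-1)!!=1\cdot3\cdot5\cdots(2j-1)$ for $j\ge1$. The indices $j_1,\dots,j_k$ are nonnegative integers. *)

theory Defs
  imports "Jordan_Normal_Form.Char_Poly" "Jordan_Normal_Form.DL_Rank" Complex_Main
    "HOL-Library.FuncSet"
begin

text \<open>The double factorial \<open>(2j-1)!!\<close>, with the empty product \<open>1\<close> for \<open>j = 0\<close>.\<close>

definition odd_double_fact :: "nat \<Rightarrow> real" where
  "odd_double_fact j = (\<Prod>i=1..j. 2 * real i - 1)"

text \<open>
  \<open>lam 1, \<dots>, lam n\<close> list the eigenvalues of \<open>A\<close>, repeated according to algebraic multiplicity
  (for a symmetric matrix this is also the geometric multiplicity).
\<close>

definition lists_eigenvalues :: "nat \<Rightarrow> real mat \<Rightarrow> (nat \<Rightarrow> real) \<Rightarrow> bool" where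
  "lists_eigenvalues n A lam \<longleftrightarrow> char_poly A = (\<Prod>i=1..n. [:- lam i, 1:])"

definition a_coeff :: "nat \<Rightarrow> nat \<Rightarrow> (nat \<Rightarrow> real) \<Rightarrow> real" where
  "a_coeff n k lam = Max ((\<lambda>i. \<bar>lam i\<bar>) ` {k+1..n})"

text \<open>In the following, \<open>r\<close> stands for the rank of \<open>A\<close> and \<open>a\<close> for \<open>a_coeff n k lam\<close>.\<close>

definition phi_coeff :: "nat \<Rightarrow> nat \<Rightarrow> real \<Rightarrow> (nat \<Rightarrow> real) \<Rightarrow> nat \<Rightarrow> real" where
  "phi_coeff r k a lam i =
     (- lam i / ((real r - real k) * a)) / (- lam i / a + 1)"

definition c_coeff :: "nat \<Rightarrow> nat \<Rightarrow> real \<Rightarrow> (nat \<Rightarrow> real) \<Rightarrow> nat \<Rightarrow> real" where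
  "c_coeff r k a lam l =
     fact ((r - k) div 2) / (\<Prod>i=1..k. sqrt (- lam i / a + 1)) *
     (\<Sum>j \<in> {j \<in> {1..k} \<rightarrow>\<^sub>E (UNIV :: nat set). (\<Sum>i=1..k. j i) = l}.
        \<Prod>i=1..k. odd_double_fact (j i) / fact (j i) * phi_coeff r k a lam i ^ j i)"

definition d_coeff :: "nat \<Rightarrow> nat \<Rightarrow> real \<Rightarrow> (nat \<Rightarrow> real) \<Rightarrow> nat \<Rightarrow> real" where
  "d_coeff r k a lam l = (\<Sum>i=1..k. (2 * phi_coeff r k a lam i) ^ l)"

end

theory Submission
  imports Defs "HOL-Computational_Algebra.Formal_Power_Series"
begin

text \<open>
  Up to a constant factor, \<open>c_coeff r k a lam l\<close> is the \<open>l\<close>-th coefficient of the formal power series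
  \<open>F = (\<Prod>i=1..k. (1 - 2 \<phi>\<^sub>i X) powr (-1/2))\<close>: the \<open>j\<close>-th coefficient of \<open>(1 - 2 \<phi> X) powr (-1/2)\<close>
  is \<open>(2j-1)!! / j! * \<phi>^j\<close>, and the sum over all \<open>(j\<^sub>1, \<dots>, j\<^sub>k)\<close> with \<open>j\<^sub>1 + \<dots> + j\<^sub>k = l\<close> is what
  multiplying \<open>k\<close> series produces (\<open>fps_nth_prod_PiE\<close>).

  The recursion is the logarithmic derivative of \<open>F\<close> read coefficientwise. A single factor has
  logarithmic derivative \<open>\<phi> / (1 - 2 \<phi> X)\<close>, a geometric series with \<open>m\<close>-th coefficient
  \<open>\<phi> (2\<phi>)^m = (2\<phi>)^(m+1) / 2\<close> (\<open>fps_deriv_inv_sqrt_series\<close>). Logarithmic derivatives of factors add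
  up (\<open>fps_deriv_prod_log\<close>), so \<open>F' = F * G\<close> where the \<open>m\<close>-th coefficient of \<open>G\<close> is half the power sum
  \<open>d_coeff r k a lam (m + 1)\<close>. Comparing the coefficients of \<open>X^(l-1)\<close> in \<open>F' = F * G\<close> gives
  \<open>l F\<^sub>l = (\<Sum>j<l. F\<^sub>j d\<^bsub>l-j\<^esub>) / 2\<close>.
\<close>

text \<open>
  The coefficients of a finite product are sums over multisets of size \<open>l\<close> (\<open>fps_prod_nth'\<close>); an
  exponent vector of total \<open>l\<close> is the multiplicity function of such a multiset.
\<close>

lemma fps_nth_prod_PiE:
  fixes f :: "'i \<Rightarrow> 'a::comm_ring_1 fps"
  assumes "finite I"
  shows "fps_nth (\<Prod>i\<in>I. f i) l =
    (\<Sum>j \<in> {j \<in> I \<rightarrow>\<^sub>E (UNIV :: nat set). (\<Sum>i\<in>I. j i) = l}. \<Prod>i\<in>I. fps_nth (f i) (j i))"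
proof -
  define mset_of where "mset_of j = (\<Sum>i\<in>I. replicate_mset (j i) i)" for j :: "'i \<Rightarrow> nat"
  have count: "count (mset_of j) i = (if i \<in> I then j i else 0)" for j i
    using assms by (simp add: mset_of_def count_sum)
  have set: "set_mset (mset_of j) \<subseteq> I" for j
    by (metis count count_eq_zero_iff subsetI)
  have size: "size X = (\<Sum>i\<in>I. count X i)" if "set_mset X \<subseteq> I" for X
    unfolding size_multiset_overloaded_eq using assms that
    by (intro sum.mono_neutral_left) (auto simp: not_in_iff)
  show ?thesis
    unfolding fps_prod_nth'[OF assms]
  proof (rule sum.reindex_bij_witness[where i = mset_of and j = "\<lambda>X. restrict (count X) I"],
      goal_cases)
    case (1 X)
    then show ?case
      by (intro multiset_eqI) (auto simp: count multisets_of_size_def simp flip: not_in_iff)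
  next
    case (2 X)
    then show ?case by (auto simp: multisets_of_size_def size)
  next
    case (3 j)
    then show ?case by (auto simp: count PiE_iff extensional_def)
  next
    case (4 j)
    then show ?case by (auto simp: multisets_of_size_def size set count)
  next
    case (5 X)
    then show ?case by simp
  qed
qed

lemma fps_nth_0_prod:
  fixes f :: "'i \<Rightarrow> 'a::comm_semiring_1 fps"
  shows "fps_nth (\<Prod>i\<in>I. f i) 0 = (\<Prod>i\<in>I. fps_nth (f i) 0)"
  by (induction I rule: infinite_finite_induct) simp_all

lemma fps_deriv_prod_log:
  fixes f g :: "'i \<Rightarrow> 'a::comm_ring_1 fps"
  assumes "finite I" and "\<And>i. i \<in> I \<Longrightarrow> fps_deriv (f i) = f i * g i"
  shows "fps_deriv (\<Prod>i\<in>I. f i) = (\<Prod>i\<in>I. f i) * (\<Sum>i\<in>I. g i)"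
  using assms by (induction I rule: finite_induct) (simp_all add: algebra_simps)

text \<open>The binomial series of \<open>(1 - 2pX) powr (-1/2)\<close>.\<close>

definition inv_sqrt_series :: "real \<Rightarrow> real fps" where
  "inv_sqrt_series p = Abs_fps (\<lambda>j. odd_double_fact j / fact j * p ^ j)"

text \<open>
  Consecutive coefficients satisfy \<open>(j + 1) f\<^bsub>j+1\<^esub> = p (2j + 1) f\<^sub>j\<close>, which is the differential equation
  \<open>(1 - 2pX) f' = p f\<close>. Since \<open>1 - 2pX\<close> and the geometric series with ratio \<open>2p\<close> are mutually inverse,
  it determines the logarithmic derivative.
\<close>

lemma fps_deriv_inv_sqrt_series:
  "fps_deriv (inv_sqrt_series p) = inv_sqrt_series p * Abs_fps (\<lambda>m. (2 * p) ^ Suc m / 2)"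
proof -
  define f where "f = inv_sqrt_series p"
  define g where "g = Abs_fps (\<lambda>m. (2 * p) ^ Suc m / 2)"
  define u where "u = 1 - fps_const (2 * p) * fps_X"
  have coeff_Suc: "real (Suc j) * fps_nth f (Suc j) = p * (2 * real j + 1) * fps_nth f j" for j
  proof -
    have "odd_double_fact (Suc j) = odd_double_fact j * (2 * real j + 1)"
      by (simp add: odd_double_fact_def)
    then show ?thesis
      by (simp add: f_def inv_sqrt_series_def del: of_nat_Suc)
  qed
  have ode: "u * fps_deriv f = fps_const p * f"
  proof (rule fps_ext)
    fix m
    show "fps_nth (u * fps_deriv f) m = fps_nth (fps_const p * f) m"
      using coeff_Suc[of m]
      by (cases m) (simp_all add: u_def left_diff_distrib mult.assoc algebra_simps)
  qed
  have geo: "u * g = fps_const p"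
  proof (rule fps_ext)
    fix m
    show "fps_nth (u * g) m = fps_nth (fps_const p) m"
      by (cases m) (simp_all add: u_def g_def left_diff_distrib mult.assoc)
  qed
  have "fps_nth u 0 = 1"
    by (simp add: u_def)
  then have "u \<noteq> 0"
    by auto
  moreover have "u * fps_deriv f = u * (f * g)"
    using ode geo by (simp add: mult.left_commute mult.commute)
  ultimately show ?thesis
    by (simp add: f_def g_def)
qed

lemma c_coeff_eq_fps_nth:
  "c_coeff r k a lam l = fact ((r - k) div 2) / (\<Prod>i=1..k. sqrt (- lam i / a + 1)) *
     fps_nth (\<Prod>i=1..k. inv_sqrt_series (phi_coeff r k a lam i)) l"
  by (simp add: c_coeff_def fps_nth_prod_PiE inv_sqrt_series_def)

lemma fps_nth_prod_inv_sqrt_series_rec: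
  fixes p :: "'i \<Rightarrow> real"
  assumes "finite I" and "l \<ge> 1"
  defines "F \<equiv> \<Prod>i\<in>I. inv_sqrt_series (p i)"
  shows "fps_nth F l =
    1 / (2 * real l) * (\<Sum>j=0..l-1. (\<Sum>i\<in>I. (2 * p i) ^ (l - j)) * fps_nth F j)"
proof -
  let ?G = "\<Sum>i\<in>I. Abs_fps (\<lambda>m. (2 * p i) ^ Suc m / 2)"
  obtain m where l: "l = Suc m"
    using \<open>l \<ge> 1\<close> by (cases l) auto
  have nth_G: "fps_nth ?G (m - j) = (\<Sum>i\<in>I. (2 * p i) ^ (l - j)) / 2" if "j \<le> m" for j
    using that by (simp add: l fps_sum_nth sum_divide_distrib Suc_diff_le)
  have "fps_deriv F = F * ?G"
    unfolding F_def using \<open>finite I\<close>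
    by (intro fps_deriv_prod_log) (simp_all only: fps_deriv_inv_sqrt_series)
  then have "real l * fps_nth F l = fps_nth (F * ?G) m"
    by (metis fps_deriv_nth l Suc_eq_plus1)
  also have "\<dots> = (\<Sum>j=0..m. fps_nth F j * ((\<Sum>i\<in>I. (2 * p i) ^ (l - j)) / 2))"
    unfolding fps_mult_nth by (intro sum.cong) (simp_all only: nth_G atLeastAtMost_iff)
  also have "\<dots> = (\<Sum>j=0..l-1. (\<Sum>i\<in>I. (2 * p i) ^ (l - j)) * fps_nth F j) / 2"
    by (simp add: l mult.commute flip: sum_divide_distrib)
  finally show ?thesis
    using \<open>l \<ge> 1\<close> by (simp add: field_simps)
qed

theorem proposition7:
  fixes A :: "real mat" and n k r :: nat and lam :: "nat \<Rightarrow> real" and a :: real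
  assumes "A \<in> carrier_mat n n"
    and "transpose_mat A = A"
    and "r = vec_space.rank n A"
    and "r \<ge> 3"
    and "lists_eigenvalues n A lam"
    and "1 \<le> k" and "k \<le> n - 1"
    and "mono_on {1..k} lam"
    and "lam k < 0"
    and "\<forall>i\<in>{k+1..n}. lam k \<le> lam i"
    and "even (int r - int k)"
    and "a = a_coeff n k lam"
    and "a > 0"
  shows "c_coeff r k a lam 0 = fact ((r - k) div 2) / (\<Prod>i=1..k. sqrt (- lam i / a + 1))
    \<and> (\<forall>l\<ge>1. c_coeff r k a lam l =
          1 / (2 * real l) * (\<Sum>j=0..l-1. d_coeff r k a lam (l - j) * c_coeff r k a lam j))"
proof (intro conjI allI impI)
  show "c_coeff r k a lam 0 = fact ((r - k) div 2) / (\<Prod>i=1..k. sqrt (- lam i / a + 1))"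
    by (simp add: c_coeff_eq_fps_nth fps_nth_0_prod inv_sqrt_series_def odd_double_fact_def)
next
  fix l :: nat
  assume "l \<ge> 1"
  define C :: real where "C = fact ((r - k) div 2) / (\<Prod>i=1..k. sqrt (- lam i / a + 1))"
  define F where "F = (\<Prod>i=1..k. inv_sqrt_series (phi_coeff r k a lam i))"
  have c: "c_coeff r k a lam j = C * fps_nth F j" for j
    by (simp only: c_coeff_eq_fps_nth C_def F_def)
  have "fps_nth F l =
      1 / (2 * real l) * (\<Sum>j=0..l-1. d_coeff r k a lam (l - j) * fps_nth F j)"
    unfolding F_def d_coeff_def using \<open>l \<ge> 1\<close> by (intro fps_nth_prod_inv_sqrt_series_rec) auto
  then show "c_coeff r k a lam l =
      1 / (2 * real l) * (\<Sum>j=0..l-1. d_coeff r k a lam (l - j) * c_coeff r k a lam j)"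
    unfolding c by (simp add: sum_distrib_left mult_ac)
qed

end
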